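(* Let $\Gamma$ be any valued graph (of finite or infinite type) with an orientation $\Omega$ without oriented cycles, and let $k$ be a sink (or a source) of $\Omega$. Then the automorphism $T_k$ of $\mathcal{F}=\mathbf{Q}(u_1,\dots,u_n)$ sends cluster variables and clusters in $\chi_\Omega$ to cluster variables and clusters in $\chi_{s_k\Omega}$, and $T_k$ induces an isomorphism from the cluster algebra $\mathcal{A}_\Omega$ to the cluster algebra $\mathcal{A}_{s_k\Omega}$.
   Context: A valued graph $\Gamma$ with vertices $1,\dots,n$ corresponds to a symmetrizable generalized Cartan matrix $A=(a_{ij})$: $i\neq j$ are joined by an edge iff $a_{ij}\neq0$, and the edge carries the pair $a_{ij},a_{ji}$ as valuation. An orientation $\Omega$ chooses a direction of each edge. A vertex is a sink (source) if no arrow starts (ends) there; $s_k\Omega$ is obtained from $\Omega$ by reversing all arrows at $k$. $B_\Omega=(b_{ij})$ is the skew-symmetrizable matrix with $b_{ij}=|a_{ij}|$ if $i\to j$, $b_{ij}=a_{ij}$ if $j\to i$, and $b_{ij}=0$ otherwise. A seed $(\underline x,B)$ in $\mathcal{F}=\mathbf{Q}(u_1,\dots,u_n)$ is a transcendence base $\underline x=(x_1,\dots,x_n)$ (generating $\mathcal F$) with an $n\times n$ skew-symmetrizable integer matrix $B=(b_{xy})$ indexed by $\underline x$. Its mutation in direction $z\in\underline x$ replaces $z$ by $z'$ with $zz'=\prod_{b_{xz}>0}x^{b_{xz}}+\prod_{b_{xz}<0}x^{-b_{xz}}$ and $B$ by $B'$ with $b'_{xy}=-b_{xy}$ if $x=z$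 or $y=z$, and $b'_{xy}=b_{xy}+\frac12(|b_{xz}|b_{zy}+b_{xz}|b_{zy}|)$ otherwise. The clusters are the $\underline x$ of seeds mutation equivalent to the initial seed $(\underline u,B)$, $\underline u=(u_1,\dots,u_n)$; their elements are the cluster variables; the cluster algebra is the subalgebra of $\mathcal{F}$ (over $\mathbf{Q}$) generated by all cluster variables. $\mathcal{A}_\Omega$ is the cluster algebra with initial seed $(\underline u,B_\Omega)$, and $\chi_\Omega$ its set of cluster variables. $T_k$ is defined by $T_k(u_j)=u_j$ for $j\neq k$ and $T_k(u_k)=u_k^{-1}\bigl(\prod_{i:\,a_{ik}<0}u_i^{-a_{ik}}+1\bigr)$. *)

theory Defs
  imports
    Complex_Main
    "HOL-Library.Poly_Mapping"
    "HOL-Computational_Algebra.Fraction_Field"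
begin

subsection \<open>Valued graphs and orientations\<close>

(* The vertices 1, ..., n are the elements of a type 'n of class {finite, linorder}. *)

definition generalized_cartan :: "('n \<Rightarrow> 'n \<Rightarrow> int) \<Rightarrow> bool" where
  "generalized_cartan A \<longleftrightarrow>
     (\<forall>i. A i i = 2) \<and>
     (\<forall>i j. i \<noteq> j \<longrightarrow> A i j \<le> 0) \<and>
     (\<forall>i j. A i j = 0 \<longleftrightarrow> A j i = 0)"

definition symmetrizable :: "('n \<Rightarrow> 'n \<Rightarrow> int) \<Rightarrow> bool" where
  "symmetrizable A \<longleftrightarrow>
     (\<exists>d :: 'n \<Rightarrow> int. (\<forall>i. d i > 0) \<and> (\<forall>i j. d i * A i j = d j * A j i))"

definition skew_symmetrizable :: "('n \<Rightarrow> 'n \<Rightarrow> int) \<Rightarrow> bool" where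
  "skew_symmetrizable B \<longleftrightarrow>
     (\<exists>d :: 'n \<Rightarrow> int. (\<forall>i. d i > 0) \<and> (\<forall>i j. d i * B i j = - (d j * B j i)))"

definition adjacent :: "('n \<Rightarrow> 'n \<Rightarrow> int) \<Rightarrow> 'n \<Rightarrow> 'n \<Rightarrow> bool" where
  "adjacent A i j \<longleftrightarrow> i \<noteq> j \<and> A i j \<noteq> 0"

(* An orientation is its set of arrows; (i, j) stands for i \<rightarrow> j. *)

definition orientation :: "('n \<Rightarrow> 'n \<Rightarrow> int) \<Rightarrow> ('n \<times> 'n) set \<Rightarrow> bool" where
  "orientation A \<Omega> \<longleftrightarrow>
     (\<forall>i j. (i, j) \<in> \<Omega> \<longrightarrow> adjacent A i j) \<and>
     (\<forall>i j. adjacent A i j \<longrightarrow> ((i, j) \<in> \<Omega> \<longleftrightarrow> (j, i) \<notin> \<Omega>))"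

definition is_sink :: "('n \<times> 'n) set \<Rightarrow> 'n \<Rightarrow> bool" where
  "is_sink \<Omega> k \<longleftrightarrow> (\<forall>j. (k, j) \<notin> \<Omega>)"

definition is_source :: "('n \<times> 'n) set \<Rightarrow> 'n \<Rightarrow> bool" where
  "is_source \<Omega> k \<longleftrightarrow> (\<forall>j. (j, k) \<notin> \<Omega>)"

definition reverse_at :: "'n \<Rightarrow> ('n \<times> 'n) set \<Rightarrow> ('n \<times> 'n) set" where
  "reverse_at k \<Omega> = {(i, j). if i = k \<or> j = k then (j, i) \<in> \<Omega> else (i, j) \<in> \<Omega>}"

definition exchange_matrix ::
    "('n \<Rightarrow> 'n \<Rightarrow> int) \<Rightarrow> ('n \<times> 'n) set \<Rightarrow> 'n \<Rightarrow> 'n \<Rightarrow> int" where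
  "exchange_matrix A \<Omega> i j =
     (if (i, j) \<in> \<Omega> then \<bar>A i j\<bar> else if (j, i) \<in> \<Omega> then A i j else 0)"


subsection \<open>The field of rational functions\<close>

(* A polynomial maps each monomial (a map from variables to exponents) to its coefficient.
   Multiplication is convolution, and the order on 'n is only used by the library
   to show that polynomials have no zero divisors. *)

type_synonym 'n ratpoly = "('n \<Rightarrow>\<^sub>0 nat) \<Rightarrow>\<^sub>0 rat"
type_synonym 'n ratfun = "'n ratpoly fract"

definition rat_const :: "rat \<Rightarrow> 'n::linorder ratfun" where
  "rat_const c = Fract (Poly_Mapping.single 0 c) 1"

definition var :: "'n::linorder \<Rightarrow> 'n ratfun" where
  "var i = Fract (Poly_Mapping.single (Poly_Mapping.single i 1) 1) 1"

definition eval_poly :: "('n \<Rightarrow> 'n ratfun) \<Rightarrow> 'n::{finite,linorder} ratpoly \<Rightarrow> 'n ratfun" where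
  "eval_poly x p =
     (\<Sum>m\<in>Poly_Mapping.keys p.
        rat_const (Poly_Mapping.lookup p m) * (\<Prod>i\<in>UNIV. x i ^ Poly_Mapping.lookup m i))"

definition algebraically_independent :: "('n \<Rightarrow> 'n::{finite,linorder} ratfun) \<Rightarrow> bool" where
  "algebraically_independent x \<longleftrightarrow> (\<forall>p. eval_poly x p = 0 \<longrightarrow> p = 0)"

(* No closure under rational scalars is required: F has characteristic 0, so every subfield
   contains them. *)
definition is_subfield :: "'n::linorder ratfun set \<Rightarrow> bool" where
  "is_subfield K \<longleftrightarrow>
     1 \<in> K \<and>
     (\<forall>f\<in>K. \<forall>g\<in>K. f - g \<in> K \<and> f * g \<in> K) \<and>
     (\<forall>f\<in>K. inverse f \<in> K)"

definition is_subalgebra :: "'n::linorder ratfun set \<Rightarrow> bool" where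
  "is_subalgebra S \<longleftrightarrow>
     (\<forall>c. rat_const c \<in> S) \<and>
     (\<forall>f\<in>S. \<forall>g\<in>S. f + g \<in> S \<and> f * g \<in> S)"

definition algebra_hom_on ::
    "'n::linorder ratfun set \<Rightarrow> ('n ratfun \<Rightarrow> 'n ratfun) \<Rightarrow> bool" where
  "algebra_hom_on S T \<longleftrightarrow>
     (\<forall>c. T (rat_const c) = rat_const c) \<and>
     (\<forall>f\<in>S. \<forall>g\<in>S. T (f + g) = T f + T g \<and> T (f * g) = T f * T g)"

definition algebra_iso ::
    "'n::linorder ratfun set \<Rightarrow> 'n ratfun set \<Rightarrow> ('n ratfun \<Rightarrow> 'n ratfun) \<Rightarrow> bool" where
  "algebra_iso S S' T \<longleftrightarrow> algebra_hom_on S T \<and> bij_betw T S S'"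


subsection \<open>Seeds, mutations, cluster algebras\<close>

(* The rows and columns of B are indexed by the positions of the tuple x; this is the same as
   indexing by the entries of x, which are distinct by algebraic independence. *)

type_synonym 'n seed = "('n \<Rightarrow> 'n ratfun) \<times> ('n \<Rightarrow> 'n \<Rightarrow> int)"

definition is_seed :: "'n::{finite,linorder} seed \<Rightarrow> bool" where
  "is_seed s \<longleftrightarrow> (case s of (x, B) \<Rightarrow>
     algebraically_independent x \<and> is_subfield hull (range x) = UNIV \<and> skew_symmetrizable B)"

definition mutate_cluster ::
    "'n \<Rightarrow> ('n \<Rightarrow> 'n ratfun) \<Rightarrow> ('n \<Rightarrow> 'n \<Rightarrow> int) \<Rightarrow> 'n \<Rightarrow> 'n::{finite,linorder} ratfun" where
  "mutate_cluster k x B =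
     x(k := ((\<Prod>i\<in>{i. B i k > 0}. x i ^ nat (B i k)) +
             (\<Prod>i\<in>{i. B i k < 0}. x i ^ nat (- B i k))) / x k)"

(* The numerator of the correction term is always even, so the integer division is exact. *)
definition mutate_matrix :: "'n \<Rightarrow> ('n \<Rightarrow> 'n \<Rightarrow> int) \<Rightarrow> 'n \<Rightarrow> 'n \<Rightarrow> int" where
  "mutate_matrix k B i j =
     (if i = k \<or> j = k then - B i j
      else B i j + (\<bar>B i k\<bar> * B k j + B i k * \<bar>B k j\<bar>) div 2)"

definition mutate :: "'n \<Rightarrow> 'n::{finite,linorder} seed \<Rightarrow> 'n seed" where
  "mutate k s = (case s of (x, B) \<Rightarrow> (mutate_cluster k x B, mutate_matrix k B))"

definition mutation_equivalent :: "'n::{finite,linorder} seed \<Rightarrow> 'n seed \<Rightarrow> bool" where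
  "mutation_equivalent = (\<lambda>s t. \<exists>k. t = mutate k s)\<^sup>*\<^sup>*"

definition clusters :: "('n \<Rightarrow> 'n \<Rightarrow> int) \<Rightarrow> ('n \<Rightarrow> 'n::{finite,linorder} ratfun) set" where
  "clusters B = {x. \<exists>B'. is_seed (x, B') \<and> mutation_equivalent (var, B) (x, B')}"

definition cluster_variables ::
    "('n \<Rightarrow> 'n \<Rightarrow> int) \<Rightarrow> 'n::{finite,linorder} ratfun set" where
  "cluster_variables B = (\<Union>x\<in>clusters B. range x)"

definition cluster_algebra ::
    "('n \<Rightarrow> 'n \<Rightarrow> int) \<Rightarrow> 'n::{finite,linorder} ratfun set" where
  "cluster_algebra B = is_subalgebra hull cluster_variables B"


subsection \<open>The map \<open>T\<^sub>k\<close>\<close>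

definition reflection_value ::
    "('n \<Rightarrow> 'n \<Rightarrow> int) \<Rightarrow> 'n \<Rightarrow> 'n \<Rightarrow> 'n::{finite,linorder} ratfun" where
  "reflection_value A k j =
     (if j = k then inverse (var k) * ((\<Prod>i\<in>{i. A i k < 0}. var i ^ nat (- A i k)) + 1)
      else var j)"

(* The unique endomorphism of the field F over the rationals with the prescribed values. *)
definition reflection ::
    "('n \<Rightarrow> 'n \<Rightarrow> int) \<Rightarrow> 'n \<Rightarrow> 'n::{finite,linorder} ratfun \<Rightarrow> 'n ratfun" where
  "reflection A k =
     (THE T. algebra_hom_on UNIV T \<and> (\<forall>j. T (var j) = reflection_value A k j))"

end

theory Submission
  imports Defs
begin

text \<open>
  The reflection carries the initial seed of \<open>\<Omega>\<close> to the mutation at \<open>k\<close> of the initial seed of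
  \<open>s\<^sub>k\<Omega>\<close>. Being a field automorphism, it commutes with all mutations, hence maps the seeds of the
  first mutation class to seeds of the second. It is an involution, so the same argument
  for \<open>s\<^sub>k\<Omega>\<close> gives the inverse map.
\<close>

subsection \<open>Evaluation of polynomials\<close>

text \<open>Updating at a key outside the support is the same as adding a single term. The rule
  serves twice: for a polynomial as a sum of terms, and for a monomial as a sum of single
  exponents.\<close>

lemma poly_mapping_induct_single_add [case_names single add]:
  assumes single: "\<And>m c. P (Poly_Mapping.single m c)"
    and add: "\<And>p q. P p \<Longrightarrow> P q \<Longrightarrow> P (p + q)"
  shows "P (p :: 'a \<Rightarrow>\<^sub>0 'b::monoid_add)"
proof (induction p rule: update_induct)
  case const
  show ?case using single[of undefined 0] by simp
next
  case (update f a b)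
  have "Poly_Mapping.update a b f = Poly_Mapping.single a b + f"
    using update.hyps(1)
    by (intro poly_mapping_eqI)
      (auto simp: lookup_update lookup_add lookup_single when_def in_keys_iff)
  then show ?case using add single update.IH by simp
qed

text \<open>Constants and variables generate the polynomial ring: a product of monomials adds their
  exponents, so powers of variables yield all monomials, and these with constants yield all
  terms.\<close>

lemma ratpoly_induct [case_names const var add mult]:
  assumes const: "\<And>c. P (Poly_Mapping.single 0 c)"
    and var: "\<And>i. P (Poly_Mapping.single (Poly_Mapping.single i 1) 1)"
    and add: "\<And>p q. P p \<Longrightarrow> P q \<Longrightarrow> P (p + q)"
    and mult: "\<And>p q. P p \<Longrightarrow> P q \<Longrightarrow> P (p * q)"
  shows "P (p :: 'n ratpoly)"
proof (induction p rule: poly_mapping_induct_single_add)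
  case (single m c)
  have power: "P (Poly_Mapping.single (Poly_Mapping.single i e) 1)" for i and e :: nat
  proof (induction e)
    case 0
    show ?case using const[of 1] by simp
  next
    case (Suc e)
    have "Poly_Mapping.single (Poly_Mapping.single i (Suc e)) 1 =
        (Poly_Mapping.single (Poly_Mapping.single i 1) 1 *
          Poly_Mapping.single (Poly_Mapping.single i e) 1 :: 'n ratpoly)"
      by (simp add: mult_single flip: single_add)
    then show ?case using mult var Suc by metis
  qed
  have "P (Poly_Mapping.single m 1)"
  proof (induction m rule: poly_mapping_induct_single_add)
    case (single i e)
    show ?case by (rule power)
  next
    case (add m m')
    have "Poly_Mapping.single (m + m') 1 =
        (Poly_Mapping.single m 1 * Poly_Mapping.single m' 1 :: 'n ratpoly)"
      by (simp add: mult_single)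
    then show ?case using mult add by metis
  qed
  from mult[OF const[of c] this] show ?case by (simp add: mult_single)
next
  case (add p q)
  then show ?case by (rule assms(3))
qed

lemma rat_const_simps [simp]:
  "rat_const 0 = (0 :: 'n::linorder ratfun)"
  "rat_const 1 = (1 :: 'n::linorder ratfun)"
  by (simp_all add: rat_const_def Zero_fract_def One_fract_def)

lemma rat_const_add: "rat_const (a + b) = rat_const a + rat_const b"
  by (simp add: rat_const_def single_add)

lemma rat_const_mult: "rat_const (a * b) = rat_const a * rat_const b"
  by (simp add: rat_const_def mult_single)

text \<open>Terms outside the support vanish. A larger index set lets two polynomials and their sum
  be evaluated over the same monomials.\<close>

lemma eval_poly_eq_sum:
  assumes "finite M" "Poly_Mapping.keys p \<subseteq> M"
  shows "eval_poly x p =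
    (\<Sum>m\<in>M. rat_const (Poly_Mapping.lookup p m) * (\<Prod>i\<in>UNIV. x i ^ Poly_Mapping.lookup m i))"
  unfolding eval_poly_def
  by (rule sum.mono_neutral_left) (use assms in \<open>auto simp: in_keys_iff\<close>)

lemma eval_poly_single:
  "eval_poly x (Poly_Mapping.single m c) =
    rat_const c * (\<Prod>i\<in>UNIV. x i ^ Poly_Mapping.lookup m i)"
  by (subst eval_poly_eq_sum[where M = "{m}"]) auto

lemma eval_poly_add: "eval_poly x (p + q) = eval_poly x p + eval_poly x q"
proof -
  let ?M = "Poly_Mapping.keys p \<union> Poly_Mapping.keys q"
  have "Poly_Mapping.keys (p + q) \<subseteq> ?M" by (rule keys_add)
  then show ?thesis
    by (simp add: eval_poly_eq_sum[where M = ?M] lookup_add rat_const_add ring_distribs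
        sum.distrib)
qed

lemma eval_poly_mult: "eval_poly x (p * q) = eval_poly x p * eval_poly x q"
proof (induction p rule: poly_mapping_induct_single_add)
  case (single m c)
  show ?case
  proof (induction q rule: poly_mapping_induct_single_add)
    case (single m' c')
    show ?case
      by (simp add: mult_single eval_poly_single rat_const_mult lookup_add power_add prod.distrib)
  qed (simp add: eval_poly_add ring_distribs)
qed (simp add: eval_poly_add ring_distribs)

lemma eval_poly_const [simp]: "eval_poly x (Poly_Mapping.single 0 c) = rat_const c"
  by (simp add: eval_poly_single)

lemma eval_poly_var [simp]:
  "eval_poly x (Poly_Mapping.single (Poly_Mapping.single i 1) 1) = x i"
proof -
  have "(\<Prod>j\<in>UNIV. x j ^ Poly_Mapping.lookup (Poly_Mapping.single i 1) j) =
      (\<Prod>j\<in>UNIV. if j = i then x j else 1)"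
    by (rule prod.cong) (auto simp: lookup_single when_def)
  then show ?thesis by (simp add: eval_poly_single prod.delta)
qed

lemma eval_poly_zero [simp]: "eval_poly x 0 = 0"
  by (simp add: eval_poly_def)

lemma eval_poly_one [simp]: "eval_poly x 1 = 1"
  using eval_poly_const[of x 1] by simp

text \<open>Evaluation at the variables is the embedding of polynomials into their fraction field;
  hence it is injective, and its values have all of the field as quotients.\<close>

lemma eval_poly_vars: "eval_poly var p = Fract p 1"
proof (induction p rule: ratpoly_induct)
  case (var i)
  show ?case by (subst eval_poly_var) (simp add: var_def)
qed (simp_all add: rat_const_def eval_poly_add eval_poly_mult)

lemma Fract_eq_eval_poly: "q \<noteq> 0 \<Longrightarrow> Fract p q = eval_poly var p / eval_poly var q"
  by (simp add: eval_poly_vars)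


subsection \<open>Endomorphisms of the field of rational functions\<close>

locale ratfun_endomorphism =
  fixes T :: "'n::{finite,linorder} ratfun \<Rightarrow> 'n ratfun"
  assumes hom: "algebra_hom_on UNIV T"
begin

lemma rat_const: "T (rat_const c) = rat_const c"
  and add: "T (f + g) = T f + T g"
  and mult: "T (f * g) = T f * T g"
  using hom by (simp_all add: algebra_hom_on_def)

lemma zero: "T 0 = 0" and one: "T 1 = 1"
  using rat_const[of 0] rat_const[of 1] by simp_all

lemma diff: "T (f - g) = T f - T g"
  using add[of "f - g" g] by simp

lemma eq_0_iff: "T f = 0 \<longleftrightarrow> f = 0"
proof
  assume "T f = 0"
  then have "T (f * inverse f) = 0" by (simp only: mult) simp
  then show "f = 0" by (metis one right_inverse zero_neq_one)
qed (simp add: zero)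

lemma inverse: "T (inverse f) = inverse (T f)"
proof (cases "f = 0")
  case False
  then have "T f * T (inverse f) = 1" by (simp add: one flip: mult)
  then show ?thesis by (metis inverse_unique)
qed (simp add: zero)

lemma divide: "T (f / g) = T f / T g"
  by (simp add: divide_inverse mult inverse)

lemma power: "T (f ^ e) = T f ^ e"
  by (induction e) (simp_all add: one mult)

lemma sum: "T (\<Sum>i\<in>I. f i) = (\<Sum>i\<in>I. T (f i))"
  by (induction I rule: infinite_finite_induct) (simp_all add: zero add)

lemma prod: "T (\<Prod>i\<in>I. f i) = (\<Prod>i\<in>I. T (f i))"
  by (induction I rule: infinite_finite_induct) (simp_all add: one mult)

lemma eval_poly: "T (eval_poly x p) = eval_poly (T \<circ> x) p"
  by (simp add: eval_poly_def sum prod mult power rat_const)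

lemma Fract: "q \<noteq> 0 \<Longrightarrow> T (Fract p q) = eval_poly (T \<circ> var) p / eval_poly (T \<circ> var) q"
  by (simp add: Fract_eq_eval_poly divide eval_poly)

text \<open>A field endomorphism is injective, so a polynomial relation among the images is already
  a relation among the entries of \<open>x\<close>.\<close>

lemma algebraically_independent:
  "algebraically_independent x \<Longrightarrow> algebraically_independent (T \<circ> x)"
  by (simp add: algebraically_independent_def eq_0_iff flip: eval_poly)

text \<open>The exchange relation is a rational expression in the cluster whose exponents depend
  only on \<open>B\<close>.\<close>

lemma mutate_cluster: "T \<circ> mutate_cluster k x B = mutate_cluster k (T \<circ> x) B"
  by (rule ext) (simp add: mutate_cluster_def divide add prod power)

lemma mutation_equivalent:
  assumes "mutation_equivalent (x, B) (y, C)"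
  shows "mutation_equivalent (T \<circ> x, B) (T \<circ> y, C)"
proof -
  \<comment> \<open>Stated for arbitrary seeds \<open>s\<close> and \<open>t\<close>, so that
    induction along the chain of mutations applies; the matrices are left alone by
    \<open>T\<close>.\<close>
  have "mutation_equivalent (T \<circ> fst s, snd s) (T \<circ> fst t, snd t)"
    if "mutation_equivalent s t" for s t
    using that unfolding mutation_equivalent_def
  proof (induction rule: rtranclp_induct)
    case (step t u)
    from step.hyps(2) obtain k where "u = mutate k t" by blast
    then have "(T \<circ> fst u, snd u) = mutate k (T \<circ> fst t, snd t)"
      by (simp add: mutate_def mutate_cluster split: prod.split)
    then show ?case by (metis (mono_tags, lifting) rtranclp.rtrancl_into_rtrancl step.IH)
  qed simp
  from this[OF assms] show ?thesis by simp
qed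

end

section \<open>Uniqueness and existence of endomorphisms with given values at the variables\<close>

lemma ratfun_endomorphism_eqI:
  fixes T T' :: "'n::{finite,linorder} ratfun \<Rightarrow> 'n ratfun"
  assumes "algebra_hom_on UNIV T" "algebra_hom_on UNIV T'" "\<And>j. T (var j) = T' (var j)"
  shows "T = T'"
proof
  fix f :: "'n ratfun"
  interpret T: ratfun_endomorphism T by unfold_locales fact
  interpret T': ratfun_endomorphism T' by unfold_locales fact
  have "T \<circ> var = T' \<circ> var" using assms(3) by auto
  moreover obtain p q where "f = Fract p q" "q \<noteq> 0" by (cases f)
  ultimately show "T f = T' f" by (simp add: T.Fract T'.Fract)
qed

text \<open>Algebraic independence keeps every denominator nonzero, so substituting \<open>x\<close>
  in numerator and denominator extends to fractions.\<close>

lemma ratfun_endomorphism_exists: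
  fixes x :: "'n::{finite,linorder} \<Rightarrow> 'n ratfun"
  assumes indep: "algebraically_independent x"
  shows "\<exists>T. algebra_hom_on UNIV T \<and> (\<forall>j. T (var j) = x j)"
proof -
  \<comment> \<open>\<open>R\<close> is the graph of the substitution over all representations of a
    fraction; independence of the representation is its single-valuedness.\<close>
  define R where "R f v \<longleftrightarrow> (\<exists>p q. q \<noteq> 0 \<and> f = Fract p q \<and> v = eval_poly x p / eval_poly x q)"
    for f v
  have nz: "eval_poly x q \<noteq> 0" if "q \<noteq> 0" for q
    using that indep by (auto simp: algebraically_independent_def)
  have unique: "v = v'" if "R f v" "R f v'" for f v v'
  proof -
    from that obtain p q p' q' where
      pq: "q \<noteq> 0" "f = Fract p q" "v = eval_poly x p / eval_poly x q" and
      pq': "q' \<noteq> 0" "f = Fract p' q'" "v' = eval_poly x p' / eval_poly x q'"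
      unfolding R_def by blast
    then have "p * q' = p' * q" by (simp add: eq_fract)
    then have "eval_poly x p * eval_poly x q' = eval_poly x p' * eval_poly x q"
      by (metis eval_poly_mult)
    with pq(3) pq'(3) nz[OF pq(1)] nz[OF pq'(1)] show ?thesis
      by (simp add: frac_eq_eq)
  qed
  define T where "T f = (THE v. R f v)" for f
  have Fract: "T (Fract p q) = eval_poly x p / eval_poly x q" if "q \<noteq> 0" for p q
  proof -
    have R: "R (Fract p q) (eval_poly x p / eval_poly x q)"
      using that unfolding R_def by blast
    then show ?thesis unfolding T_def by (rule the_equality) (rule unique[OF _ R])
  qed
  have "T (f + g) = T f + T g \<and> T (f * g) = T f * T g" for f g
  proof -
    obtain p q where f: "f = Fract p q" "q \<noteq> 0" by (cases f)
    obtain p' q' where g: "g = Fract p' q'" "q' \<noteq> 0" by (cases g)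
    show ?thesis
      using f(2) g(2) nz[OF f(2)] nz[OF g(2)]
      by (simp add: f(1) g(1) Fract eval_poly_add eval_poly_mult add_frac_eq)
  qed
  moreover have "T (rat_const c) = rat_const c" for c
    by (simp add: rat_const_def Fract flip: One_fract_def)
  moreover have "T (var j) = x j" for j
    using eval_poly_var[of x j] by (simp add: var_def Fract)
  ultimately show ?thesis by (intro exI[of _ T]) (simp add: algebra_hom_on_def)
qed

section \<open>Action of involutive endomorphisms on seeds and cluster algebras\<close>

locale ratfun_involution = ratfun_endomorphism +
  assumes involution: "T (T f) = f"
begin

lemma bij: "bij T"
  by (rule involuntory_imp_bij) (rule involution)

text \<open>The preimage under \<open>T\<close> of the subfield generated by the images is a
  subfield containing the entries of \<open>x\<close>, hence the whole field.\<close>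

lemma generates:
  assumes "is_subfield hull (range x) = UNIV"
  shows "is_subfield hull (range (T \<circ> x)) = UNIV"
proof -
  let ?K = "is_subfield hull (range (T \<circ> x))"
  have "is_subfield ?K" by (rule hull_in) (auto simp: is_subfield_def)
  then have "is_subfield (T -` ?K)"
    unfolding is_subfield_def by (simp add: one diff mult inverse)
  moreover have "range x \<subseteq> T -` ?K" by (auto intro!: hull_inc)
  ultimately have "is_subfield hull (range x) \<subseteq> T -` ?K" by (intro hull_minimal)
  with assms have "T f \<in> ?K" for f by auto
  \<comment> \<open>Surjectivity: every element is the image under \<open>T\<close> of its own
    image.\<close>
  from this[of "T _"] show ?thesis by (auto simp: involution)
qed

lemma is_seed: "is_seed (x, B) \<Longrightarrow> is_seed (T \<circ> x, B)"
  using algebraically_independent generates unfolding is_seed_def prod.case by blast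

text \<open>The preimage of a subalgebra is a subalgebra, so it suffices to check the
  generators.\<close>

lemma cluster_algebra_subset:
  assumes "\<And>f. f \<in> cluster_variables B \<Longrightarrow> T f \<in> cluster_variables B'"
  shows "T ` cluster_algebra B \<subseteq> cluster_algebra B'"
proof -
  have "is_subalgebra (cluster_algebra B')"
    unfolding cluster_algebra_def by (rule hull_in) (auto simp: is_subalgebra_def)
  then have "is_subalgebra (T -` cluster_algebra B')"
    unfolding is_subalgebra_def by (simp add: rat_const add mult)
  moreover have "cluster_variables B \<subseteq> T -` cluster_algebra B'"
    using assms by (auto simp: cluster_algebra_def intro!: hull_inc)
  ultimately have "cluster_algebra B \<subseteq> T -` cluster_algebra B'"
    unfolding cluster_algebra_def[of B] by (intro hull_minimal)
  then show ?thesis by blast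
qed

end


subsection \<open>The reflection\<close>

text \<open>The numerator of the new value at \<open>k\<close> is a polynomial \<open>c\<close> free
  of the variable \<open>k\<close>, because \<open>A k k \<ge> 0\<close> keeps \<open>k\<close> out
  of the product. The substitution changes only that variable, so it fixes \<open>c\<close>.\<close>

lemma reflection_value_poly:
  fixes A :: "'n::{finite,linorder} \<Rightarrow> 'n \<Rightarrow> int"
  assumes "A k k \<ge> 0"
  obtains c where "c \<noteq> 0"
    "eval_poly var c = (\<Prod>i\<in>{i. A i k < 0}. var i ^ nat (- A i k)) + 1"
    "eval_poly (reflection_value A k) c = eval_poly var c"
proof -
  define m where "m = (\<Sum>i\<in>{i. A i k < 0}. Poly_Mapping.single i (nat (- A i k)))"
  define c :: "'n ratpoly" where "c = Poly_Mapping.single m 1 + 1"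
  have "Poly_Mapping.lookup m i = (if A i k < 0 then nat (- A i k) else 0)" for i
    by (simp add: m_def lookup_sum lookup_single when_def)
  then have "(\<Prod>i\<in>UNIV. x i ^ Poly_Mapping.lookup m i) = (\<Prod>i\<in>{i. A i k < 0}. x i ^ nat (- A i k))"
    for x :: "'n \<Rightarrow> 'n ratfun"
    by (intro prod.mono_neutral_cong_right) auto
  then have c: "eval_poly x c = (\<Prod>i\<in>{i. A i k < 0}. x i ^ nat (- A i k)) + 1" for x
    by (simp add: c_def eval_poly_add eval_poly_single)
  \<comment> \<open>The constant coefficient is 1, or 2 when the product is empty and
    \<open>m = 0\<close>.\<close>
  have "Poly_Mapping.lookup c 0 \<noteq> 0"
    by (simp add: c_def lookup_add lookup_single lookup_one when_def)
  then have "c \<noteq> 0" by auto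
  moreover have "eval_poly (reflection_value A k) c = eval_poly var c"
    unfolding c using assms
    by (intro arg_cong2[where f = "(+)"] prod.cong) (auto simp: reflection_value_def)
  ultimately show ?thesis using that c by blast
qed

lemma var_nonzero: "var k \<noteq> 0"
proof -
  have "Poly_Mapping.lookup (Poly_Mapping.single (Poly_Mapping.single k (1::nat)) (1::rat)) (Poly_Mapping.single k 1) \<noteq> 0"
    by simp
  then have "Poly_Mapping.single (Poly_Mapping.single k (1::nat)) (1::rat) \<noteq> 0"
    by (metis lookup_zero)
  then show ?thesis by (simp add: var_def Zero_fract_def eq_fract)
qed

text \<open>
  Substituting the values of the reflection in \<open>p\<close> and clearing the denominator \<open>u\<^sub>k\<^sup>N\<close> gives a
  polynomial \<open>q\<close>. Because the substitution is formally an involution, substituting once more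
  returns \<open>p\<close> up to a nonzero factor; so \<open>q = 0\<close> forces \<open>p = 0\<close>.
\<close>

lemma algebraically_independent_reflection_value:
  fixes A :: "'n::{finite,linorder} \<Rightarrow> 'n \<Rightarrow> int"
  assumes "A k k \<ge> 0"
  shows "algebraically_independent (reflection_value A k)"
proof -
  define v where "v = reflection_value A k"
  obtain c where c: "c \<noteq> 0"
      "eval_poly var c = (\<Prod>i\<in>{i. A i k < 0}. var i ^ nat (- A i k)) + 1"
      "eval_poly v c = eval_poly var c"
    by (rule reflection_value_poly[of A k, OF assms, folded v_def])
  have "eval_poly var c \<noteq> 0"
    using c(1) by (simp add: eval_poly_vars Zero_fract_def eq_fract)
  moreover have vk: "v k = eval_poly var c / var k"
    by (simp add: v_def reflection_value_def c(2) divide_inverse mult.commute)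
  ultimately have "v k \<noteq> 0" using var_nonzero by simp
  \<comment> \<open>The second equation is the first with \<open>var\<close> and \<open>v\<close>
    exchanged. Carrying both through the induction replaces applying the reflection as a field map,
    which is not yet known to exist.\<close>
  have ex: "\<exists>N q. eval_poly var q = var k ^ N * eval_poly v p \<and>
      eval_poly v q = v k ^ N * eval_poly var p" for p
  proof (induction p rule: ratpoly_induct)
    case (const a)
    show ?case
      by (rule exI[of _ 0], rule exI[of _ "Poly_Mapping.single 0 a"]) simp
  next
    case (var i)
    let ?u = "Poly_Mapping.single (Poly_Mapping.single i 1) 1 :: 'n ratpoly"
    show ?case
    proof (cases "i = k")
      case True
      show ?thesis
        \<comment> \<open>Here \<open>c\<close> is the product of \<open>var k\<close> and
          \<open>v k\<close>, a relation symmetric in both since \<open>c\<close> takes the same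
          value at \<open>var\<close> and at \<open>v\<close>.\<close>
        by (rule exI[of _ 1], rule exI[of _ c])
          (unfold eval_poly_var, simp add: True vk c(3) var_nonzero)
    next
      case False
      then have "v i = Defs.var i" by (simp add: v_def reflection_value_def)
      then show ?thesis
        by (intro exI[of _ 0] exI[of _ ?u]) (unfold eval_poly_var, simp)
    qed
  next
    case (add p p')
    then obtain N q N' q' where
      "eval_poly var q = var k ^ N * eval_poly v p" "eval_poly v q = v k ^ N * eval_poly var p"
      "eval_poly var q' = var k ^ N' * eval_poly v p'" "eval_poly v q' = v k ^ N' * eval_poly var p'"
      by blast
    moreover define u where "u = (Poly_Mapping.single (Poly_Mapping.single k 1) 1 :: 'n ratpoly)"
    moreover have "eval_poly x (u ^ e) = x k ^ e" for x :: "'n \<Rightarrow> 'n ratfun" and e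
      unfolding u_def by (induction e) (simp, simp only: power_Suc eval_poly_mult eval_poly_var)
    ultimately show ?case
      \<comment> \<open>Each summand is multiplied by the missing power of the variable
        \<open>u\<close> to reach the common exponent \<open>N + N'\<close>.\<close>
      by (intro exI[of _ "N + N'"] exI[of _ "u ^ N' * q + u ^ N * q'"])
        (simp add: eval_poly_add eval_poly_mult power_add algebra_simps)
  next
    case (mult p p')
    then obtain N q N' q' where
      "eval_poly var q = var k ^ N * eval_poly v p" "eval_poly v q = v k ^ N * eval_poly var p"
      "eval_poly var q' = var k ^ N' * eval_poly v p'" "eval_poly v q' = v k ^ N' * eval_poly var p'"
      by blast
    then show ?case
      by (intro exI[of _ "N + N'"] exI[of _ "q * q'"])
        (simp add: eval_poly_mult power_add algebra_simps)
  qed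
  have "p = 0" if "eval_poly v p = 0" for p
  proof -
    from ex[of p] that obtain N q where
      "eval_poly var q = 0" and q: "eval_poly v q = v k ^ N * eval_poly var p"
      by auto
    then have "q = 0" by (simp add: eval_poly_vars Zero_fract_def eq_fract)
    with q \<open>v k \<noteq> 0\<close> have "eval_poly var p = 0" by simp
    then show ?thesis by (simp add: eval_poly_vars Zero_fract_def eq_fract)
  qed
  then show ?thesis by (simp add: algebraically_independent_def v_def)
qed

text \<open>The definite description is justified: independence of the prescribed values gives
  existence, and agreement on the variables gives uniqueness.\<close>

lemma reflection_hom:
  fixes A :: "'n::{finite,linorder} \<Rightarrow> 'n \<Rightarrow> int"
  assumes "A k k \<ge> 0"
  shows "algebra_hom_on UNIV (reflection A k)"
    and reflection_var: "reflection A k (var j) = reflection_value A k j"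
proof -
  obtain T where
    "algebra_hom_on UNIV T \<and> (\<forall>j. T (var j) = reflection_value A k j)"
    using ratfun_endomorphism_exists[OF algebraically_independent_reflection_value[of A k, OF assms]]
    by blast
  then have "\<exists>!T. algebra_hom_on UNIV T \<and> (\<forall>j. T (var j) = reflection_value A k j)"
    by (intro ex1I[of _ T]) (auto intro!: ratfun_endomorphism_eqI)
  from theI'[OF this] have "algebra_hom_on UNIV (reflection A k) \<and>
      (\<forall>j. reflection A k (var j) = reflection_value A k j)"
    unfolding reflection_def .
  then show "algebra_hom_on UNIV (reflection A k)"
    "reflection A k (var j) = reflection_value A k j" by auto
qed

text \<open>The map sends \<open>var k\<close> to \<open>C / var k\<close> and fixes both
  \<open>C\<close> and the other variables. Its square therefore fixes every variable and must be
  the identity.\<close>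

lemma reflection_involution:
  fixes A :: "'n::{finite,linorder} \<Rightarrow> 'n \<Rightarrow> int"
  assumes "A k k \<ge> 0"
  shows "ratfun_involution (reflection A k)"
proof -
  define T where "T = reflection A k"
  interpret T: ratfun_endomorphism T
    unfolding T_def using reflection_hom[of A k, OF assms] by unfold_locales
  have var: "T (var j) = reflection_value A k j" for j
    unfolding T_def by (rule reflection_var) fact
  obtain c where c: "c \<noteq> 0"
      "eval_poly var c = (\<Prod>i\<in>{i. A i k < 0}. var i ^ nat (- A i k)) + 1"
      "eval_poly (reflection_value A k) c = eval_poly var c"
    by (rule reflection_value_poly[of A k, OF assms])
  define C where "C = eval_poly var c"
  have "T \<circ> var = reflection_value A k" using var by auto
  then have "T C = C" by (simp add: C_def T.eval_poly c(3))
  have "C \<noteq> 0"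
    using c(1) by (simp add: C_def eval_poly_vars Zero_fract_def eq_fract)
  have Tk: "T (var k) = C / var k"
    by (simp add: var reflection_value_def C_def c(2) divide_inverse mult.commute)
  have "T (T (var j)) = var j" for j
  proof (cases "j = k")
    case True
    with \<open>T C = C\<close> \<open>C \<noteq> 0\<close> show ?thesis by (simp add: Tk T.divide var_nonzero)
  qed (simp add: var reflection_value_def)
  moreover have "algebra_hom_on UNIV (T \<circ> T)"
    by (simp add: algebra_hom_on_def T.rat_const T.add T.mult)
  ultimately have "T \<circ> T = id"
    by (intro ratfun_endomorphism_eqI) (auto simp: algebra_hom_on_def)
  then show ?thesis
    unfolding T_def[symmetric] by unfold_locales (simp add: fun_eq_iff)
qed


subsection \<open>Reversing the arrows at a sink or a source\<close>

lemma reverse_at_iff: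
  "(i, j) \<in> reverse_at k \<Omega> \<longleftrightarrow> (if i = k \<or> j = k then (j, i) \<in> \<Omega> else (i, j) \<in> \<Omega>)"
  by (simp add: reverse_at_def)

lemma reverse_at_reverse_at [simp]: "reverse_at k (reverse_at k \<Omega>) = \<Omega>"
  by (rule set_eqI) (simp add: split_paired_all reverse_at_iff)

lemma adjacent_sym: "generalized_cartan A \<Longrightarrow> adjacent A i j \<longleftrightarrow> adjacent A j i"
  by (auto simp: generalized_cartan_def adjacent_def)

text \<open>The diagonal entries are 2, so negative entries mark exactly the edges. The product in
  the reflection thus runs over the neighbours of \<open>k\<close>, whatever the
  orientation.\<close>

lemma negative_iff_arrow:
  assumes "generalized_cartan A" "orientation A \<Omega>"
  shows "A i j < 0 \<longleftrightarrow> (i, j) \<in> \<Omega> \<or> (j, i) \<in> \<Omega>"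
proof -
  have "A i j = 2" if "i = j" using that assms(1) by (simp add: generalized_cartan_def)
  moreover have "A i j \<le> 0" if "i \<noteq> j" using that assms(1) by (simp add: generalized_cartan_def)
  ultimately have "A i j < 0 \<longleftrightarrow> adjacent A i j" unfolding adjacent_def by fastforce
  also have "\<dots> \<longleftrightarrow> (i, j) \<in> \<Omega> \<or> (j, i) \<in> \<Omega>"
    using assms(2) adjacent_sym[OF assms(1)] unfolding orientation_def by blast
  finally show ?thesis .
qed

lemma orientation_reverse_at:
  assumes "generalized_cartan A" "orientation A \<Omega>"
  shows "orientation A (reverse_at k \<Omega>)"
  using assms(2) adjacent_sym[OF assms(1)]
  unfolding orientation_def reverse_at_iff if_bool_eq_conj by blast

text \<open>Reversal turns a sink into a source and conversely; the disjunction is the form that is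
  stable, so results for \<open>\<Omega>\<close> apply to the reversed orientation too.\<close>

lemma sink_or_source_reverse_at:
  "is_sink \<Omega> k \<or> is_source \<Omega> k \<Longrightarrow> is_sink (reverse_at k \<Omega>) k \<or> is_source (reverse_at k \<Omega>) k"
  by (auto simp: is_sink_def is_source_def reverse_at_iff)

lemma mutate_matrix_sink_or_source:
  assumes "generalized_cartan A" "orientation A \<Omega>" "is_sink \<Omega> k \<or> is_source \<Omega> k"
  shows "mutate_matrix k (exchange_matrix A \<Omega>) = exchange_matrix A (reverse_at k \<Omega>)"
proof (intro ext)
  fix i j
  let ?B = "exchange_matrix A \<Omega>"
  have neg: "A i j < 0" if "(i, j) \<in> \<Omega> \<or> (j, i) \<in> \<Omega>" for i j
    using that negative_iff_arrow[OF assms(1,2)] by blast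
  have anti: "(j, i) \<notin> \<Omega>" if "(i, j) \<in> \<Omega>" for i j
    using that assms(2) unfolding orientation_def by blast
  show "mutate_matrix k ?B i j = exchange_matrix A (reverse_at k \<Omega>) i j"
  proof (cases "i = k \<or> j = k")
    \<comment> \<open>In row and column \<open>k\<close>, negating an entry is the same as reversing
      its arrow.\<close>
    case True
    then show ?thesis
      using neg[of i j] anti[of i j]
      by (auto simp: mutate_matrix_def exchange_matrix_def reverse_at_iff)
  next
    case False
    \<comment> \<open>At a sink \<open>?B i k \<ge> 0\<close> and \<open>?B k j \<le> 0\<close>, at
      a source the other way round; the two products cancel.\<close>
    have "\<bar>?B i k\<bar> * ?B k j + ?B i k * \<bar>?B k j\<bar> = 0"
      using assms(3) neg[of i k] neg[of k j]
      by (auto simp: exchange_matrix_def is_sink_def is_source_def)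
    with False show ?thesis
      by (simp add: mutate_matrix_def exchange_matrix_def reverse_at_iff)
  qed
qed

text \<open>Column \<open>k\<close> has no two entries of opposite sign, so one of the two exchange
  monomials is the empty product 1. Sink and source differ only in which one, and the sum is the
  same.\<close>

lemma mutate_cluster_sink_or_source:
  assumes "generalized_cartan A" "orientation A \<Omega>" "is_sink \<Omega> k \<or> is_source \<Omega> k"
  shows "mutate_cluster k var (exchange_matrix A \<Omega>) = reflection_value A k"
proof -
  let ?B = "exchange_matrix A \<Omega>" and ?N = "{i. A i k < 0}"
  note arrow = negative_iff_arrow[OF assms(1,2)]
  have "?B i k = - A i k \<and> ?B i k > 0" if "is_sink \<Omega> k" "A i k < 0" for i
    using that arrow[of i k] by (auto simp: exchange_matrix_def is_sink_def)
  moreover have "?B i k = A i k \<and> ?B i k < 0" if "is_source \<Omega> k" "A i k < 0" for i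
    using that arrow[of i k] by (auto simp: exchange_matrix_def is_source_def)
  moreover have "?B i k = 0" if "\<not> A i k < 0" for i
    using that arrow[of i k] by (auto simp: exchange_matrix_def)
  ultimately have "?B i k = (if A i k < 0 then if is_sink \<Omega> k then - A i k else A i k else 0)" for i
    using assms(3) by auto
  then have B:
    "{i. ?B i k > 0} = (if is_sink \<Omega> k then ?N else {})"
    "{i. ?B i k < 0} = (if is_sink \<Omega> k then {} else ?N)"
    "i \<in> ?N \<Longrightarrow> ?B i k = (if is_sink \<Omega> k then - A i k else A i k)" for i
    by auto
  have "(\<Prod>i\<in>{i. ?B i k > 0}. var i ^ nat (?B i k)) + (\<Prod>i\<in>{i. ?B i k < 0}. var i ^ nat (- ?B i k)) =
      (\<Prod>i\<in>?N. var i ^ nat (- A i k)) + 1"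
    unfolding B(1,2) by (cases "is_sink \<Omega> k") (simp_all add: B(3) add.commute)
  then show ?thesis
    by (auto simp: mutate_cluster_def reflection_value_def divide_inverse mult.commute)
qed

section \<open>Transport of clusters, cluster variables and cluster algebras\<close>

lemma reflection_cluster:
  assumes "generalized_cartan A" "orientation A \<Omega>" "is_sink \<Omega> k \<or> is_source \<Omega> k"
    and "x \<in> clusters (exchange_matrix A \<Omega>)"
  shows "reflection A k \<circ> x \<in> clusters (exchange_matrix A (reverse_at k \<Omega>))"
proof -
  let ?T = "reflection A k" and ?\<Omega>' = "reverse_at k \<Omega>"
  have pos: "A k k \<ge> 0" using assms(1) by (simp add: generalized_cartan_def)
  interpret ratfun_involution ?T by (rule reflection_involution[of A k, OF pos])
  from assms(4) obtain B where B: "is_seed (x, B)"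
      "mutation_equivalent (var, exchange_matrix A \<Omega>) (x, B)"
    by (auto simp: clusters_def)
  have "orientation A ?\<Omega>'" "is_sink ?\<Omega>' k \<or> is_source ?\<Omega>' k"
    by (rule orientation_reverse_at[OF assms(1,2)], rule sink_or_source_reverse_at[OF assms(3)])
  \<comment> \<open>The mutation formulas are applied to the reversed orientation; reversing it once
    more restores \<open>\<Omega>\<close>.\<close>
  then have "mutate k (var, exchange_matrix A ?\<Omega>') = (reflection_value A k, exchange_matrix A \<Omega>)"
    by (simp add: mutate_def mutate_cluster_sink_or_source mutate_matrix_sink_or_source assms(1))
  also have "reflection_value A k = ?T \<circ> var"
    using reflection_var[of A k] pos by auto
  \<comment> \<open>The mutation at \<open>k\<close> is put in front of the image under
    \<open>?T\<close> of the chain leading to \<open>x\<close>.\<close>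
  finally have "mutation_equivalent (var, exchange_matrix A ?\<Omega>') (?T \<circ> x, B)"
    using mutation_equivalent[OF B(2)] unfolding mutation_equivalent_def
    by (metis (mono_tags, lifting) converse_rtranclp_into_rtranclp)
  with is_seed[OF B(1)] show ?thesis by (auto simp: clusters_def)
qed

lemma reflection_cluster_variable:
  assumes "generalized_cartan A" "orientation A \<Omega>" "is_sink \<Omega> k \<or> is_source \<Omega> k"
    and "f \<in> cluster_variables (exchange_matrix A \<Omega>)"
  shows "reflection A k f \<in> cluster_variables (exchange_matrix A (reverse_at k \<Omega>))"
proof -
  obtain x j where "x \<in> clusters (exchange_matrix A \<Omega>)" "f = x j"
    using assms(4) by (auto simp: cluster_variables_def)
  then have "reflection A k f = (reflection A k \<circ> x) j"
    "reflection A k \<circ> x \<in> clusters (exchange_matrix A (reverse_at k \<Omega>))"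
    using reflection_cluster[OF assms(1-3)] by auto
  then show ?thesis unfolding cluster_variables_def by blast
qed

theorem mainTheorem4:
  fixes A :: "'n::{finite,linorder} \<Rightarrow> 'n \<Rightarrow> int"
    and \<Omega> :: "('n \<times> 'n) set"
    and k :: 'n
  assumes "generalized_cartan A"
    and "symmetrizable A"
    and "orientation A \<Omega>"
    and "acyclic \<Omega>"
    and "is_sink \<Omega> k \<or> is_source \<Omega> k"
  shows "algebra_iso UNIV UNIV (reflection A k) \<and>
    (\<forall>j. reflection A k (var j) = reflection_value A k j) \<and>
    (\<forall>f \<in> cluster_variables (exchange_matrix A \<Omega>).
       reflection A k f \<in> cluster_variables (exchange_matrix A (reverse_at k \<Omega>))) \<and>
    (\<forall>x \<in> clusters (exchange_matrix A \<Omega>).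
       reflection A k \<circ> x \<in> clusters (exchange_matrix A (reverse_at k \<Omega>))) \<and>
    algebra_iso (cluster_algebra (exchange_matrix A \<Omega>))
      (cluster_algebra (exchange_matrix A (reverse_at k \<Omega>))) (reflection A k)"
proof (intro conjI allI ballI)
  let ?T = "reflection A k" and ?B = "exchange_matrix A \<Omega>"
    and ?B' = "exchange_matrix A (reverse_at k \<Omega>)"
  have pos: "A k k \<ge> 0" using assms(1) by (simp add: generalized_cartan_def)
  interpret ratfun_involution ?T by (rule reflection_involution[of A k, OF pos])
  show "algebra_iso UNIV UNIV ?T" using hom bij by (simp add: algebra_iso_def)
  show "?T (var j) = reflection_value A k j" for j by (rule reflection_var) fact
  show vars: "?T f \<in> cluster_variables ?B'" if "f \<in> cluster_variables ?B" for f
    using reflection_cluster_variable[OF assms(1,3,5) that] .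
  show "?T \<circ> x \<in> clusters ?B'" if "x \<in> clusters ?B" for x
    using reflection_cluster[OF assms(1,3,5) that] .
  have "orientation A (reverse_at k \<Omega>)"
      "is_sink (reverse_at k \<Omega>) k \<or> is_source (reverse_at k \<Omega>) k"
    by (rule orientation_reverse_at[OF assms(1,3)], rule sink_or_source_reverse_at[OF assms(5)])
  \<comment> \<open>The same map serves the way back, since the reflection depends on
    \<open>A\<close> and \<open>k\<close> only and double reversal gives
    \<open>\<Omega>\<close>.\<close>
  from reflection_cluster_variable[OF assms(1) this]
  have vars': "?T f \<in> cluster_variables ?B" if "f \<in> cluster_variables ?B'" for f
    using that by simp
  have "bij_betw ?T (cluster_algebra ?B) (cluster_algebra ?B')"
    by (rule bij_betw_byWitness[where f' = ?T])
      (simp_all add: involution cluster_algebra_subset vars vars')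
  moreover have "algebra_hom_on (cluster_algebra ?B) ?T"
    using hom by (simp add: algebra_hom_on_def)
  ultimately show "algebra_iso (cluster_algebra ?B) (cluster_algebra ?B') ?T"
    by (simp add: algebra_iso_def)
qed

end
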